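(* Let $q\ge2$, and let $t,n$ be positive integers with $t\ge3$ and $3\le n<\frac{15+\sqrt{33}}{24}(t-1)^2$. A code $\mathcal C\subseteq Q^n$ is a wide-sense $t$-frameproof code of size $n$ if and only if its representation matrix in standard form is a permutation matrix of degree $n$.
   Context: Let $Q=\{0,1,\dots,q-1\}$. For a nonempty set $X=\{\mathbf c^1,\dots,\mathbf c^s\}\subseteq Q^n$, a position $i\in[n]$ is undetectable for $X$ if $c^1_i=\dots=c^s_i$; let $U(X)$ be the set of undetectable positions and $\mathrm{wdesc}(X)=\{\mathbf y\in Q^n: y_i=c^1_i \text{ for all } i\in U(X)\}$. For $t\ge2$, a code $\mathcal C\subseteq Q^n$ is a wide-sense $t$-frameproof code if $\mathrm{wdesc}(X)\cap\mathcal C=X$ for every nonempty $X\subseteq\mathcal C$ with $|X|\le t$. The representation matrix of $\mathcal C$ is the $n\times|\mathcal C|$ matrix over $Q$ whose columns are the codewords of $\mathcal C$. Permuting the symbols $0,\dots,q-1$ separately within each row gives an equivalent code. For a row $r$ and $i\in Q$, let $\lambda_i(r)$ be the number of entries equal to $i$ in row $r$; the representation matrix is in standard form if $\lambda_0(r)\ge\lambda_1(r)\ge\dots\ge\lambda_{q-1}(r)$ for every row $r$; "its representation matrix in standard form" means a matrix in standard form obtained from the representation matrix by such within-row symbol permutations. A permutation matrix of degree $n$ is an $n\times n$ $0/1$ matrix with exactly one $1$ in each row and each column. *)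

theory Defs
  imports Complex_Main "HOL-Combinatorics.Permutations" "Jordan_Normal_Form.Matrix"
begin

text \<open>The alphabet is \<open>{0, \<dots>, q - 1}\<close>; positions are indexed by \<open>0, \<dots>, n - 1\<close>.\<close>

definition words :: "nat \<Rightarrow> nat \<Rightarrow> nat vec set" where
  "words q n = {v \<in> carrier_vec n. \<forall>i<n. v $ i < q}"

definition undetectable :: "nat \<Rightarrow> nat vec set \<Rightarrow> nat set" where
  "undetectable n X = {i. i < n \<and> (\<forall>c\<in>X. \<forall>d\<in>X. c $ i = d $ i)}"

definition wdesc :: "nat \<Rightarrow> nat \<Rightarrow> nat vec set \<Rightarrow> nat vec set" where
  "wdesc q n X = {y \<in> words q n. \<forall>i\<in>undetectable n X. \<forall>c\<in>X. y $ i = c $ i}"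

definition wide_sense_frameproof :: "nat \<Rightarrow> nat \<Rightarrow> nat \<Rightarrow> nat vec set \<Rightarrow> bool" where
  "wide_sense_frameproof q n t C \<longleftrightarrow> C \<subseteq> words q n \<and>
     (\<forall>X. X \<noteq> {} \<and> X \<subseteq> C \<and> card X \<le> t \<longrightarrow> wdesc q n X \<inter> C = X)"

text \<open>The order in which the codewords appear as columns is arbitrary.\<close>

definition representation_matrix :: "nat \<Rightarrow> nat vec set \<Rightarrow> nat mat \<Rightarrow> bool" where
  "representation_matrix n C M \<longleftrightarrow>
     (\<exists>cs. distinct cs \<and> set cs = C \<and> M = mat_of_cols n cs)"

definition symbol_equivalent :: "nat \<Rightarrow> nat mat \<Rightarrow> nat mat \<Rightarrow> bool" where
  "symbol_equivalent q M M' \<longleftrightarrow>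
     dim_row M' = dim_row M \<and> dim_col M' = dim_col M \<and>
     (\<forall>r<dim_row M. \<exists>\<pi>. \<pi> permutes {..<q} \<and>
        (\<forall>j<dim_col M. M' $$ (r, j) = \<pi> (M $$ (r, j))))"

definition symbol_count :: "nat mat \<Rightarrow> nat \<Rightarrow> nat \<Rightarrow> nat" where
  "symbol_count M r i = card {j. j < dim_col M \<and> M $$ (r, j) = i}"

definition standard_form :: "nat \<Rightarrow> nat mat \<Rightarrow> bool" where
  "standard_form q M \<longleftrightarrow>
     (\<forall>r<dim_row M. \<forall>i. Suc i < q \<longrightarrow> symbol_count M r (Suc i) \<le> symbol_count M r i)"

definition standard_representation_matrix :: "nat \<Rightarrow> nat \<Rightarrow> nat vec set \<Rightarrow> nat mat \<Rightarrow> bool" where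
  "standard_representation_matrix q n C M' \<longleftrightarrow>
     (\<exists>M. representation_matrix n C M \<and> symbol_equivalent q M M' \<and> standard_form q M')"

definition permutation_matrix :: "nat \<Rightarrow> nat mat \<Rightarrow> bool" where
  "permutation_matrix n M \<longleftrightarrow> M \<in> carrier_mat n n \<and>
     (\<forall>i<n. \<forall>j<n. M $$ (i, j) \<in> {0, 1}) \<and>
     (\<forall>i<n. \<exists>!j. j < n \<and> M $$ (i, j) = 1) \<and>
     (\<forall>j<n. \<exists>!i. i < n \<and> M $$ (i, j) = 1)"

text \<open>A matrix in standard form exists for every code (it need not be unique: the order of the
  columns is free, and symbols occurring equally often in a row may be interchanged).\<close>

lemma finite_words: "finite (words q n)"
proof -
  have "words q n \<subseteq> vec_of_list ` {xs. set xs \<subseteq> {..<q} \<and> length xs = n}"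
  proof
    fix v assume v: "v \<in> words q n"
    have "set (list_of_vec v) \<subseteq> {..<q}"
      using v by (auto simp: words_def in_set_conv_nth list_of_vec_index)
    moreover have "length (list_of_vec v) = n" using v by (auto simp: words_def)
    moreover have "v = vec_of_list (list_of_vec v)" by (simp add: vec_list)
    ultimately show "v \<in> vec_of_list ` {xs. set xs \<subseteq> {..<q} \<and> length xs = n}" by blast
  qed
  then show ?thesis using finite_lists_length_eq[of "{..<q}" n] finite_surj by blast
qed

lemma ex_sorting_permutation:
  fixes f :: "nat \<Rightarrow> nat"
  shows "\<exists>\<tau>. \<tau> permutes {..<q} \<and> (\<forall>i. Suc i < q \<longrightarrow> f (\<tau> (Suc i)) \<le> f (\<tau> i))"
proof -
  define xs where "xs = sort_key (\<lambda>i. - int (f i)) [0..<q]"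
  have d: "distinct xs" and s: "set xs = {..<q}" and l: "length xs = q"
    by (simp_all add: xs_def atLeast0LessThan)
  define \<tau> where "\<tau> = (\<lambda>k. if k < q then xs ! k else k)"
  have "bij_betw ((!) xs) {..<q} {..<q}"
    by (rule bij_betw_nth[OF d]) (simp_all add: s l)
  then have "bij_betw \<tau> {..<q} {..<q}"
    using bij_betw_cong[of "{..<q}" \<tau> "(!) xs" "{..<q}"] by (simp add: \<tau>_def)
  then have "\<tau> permutes {..<q}"
    by (rule bij_imp_permutes) (auto simp: \<tau>_def)
  moreover have "f (\<tau> (Suc i)) \<le> f (\<tau> i)" if "Suc i < q" for i
  proof -
    have "sorted (map (\<lambda>i. - int (f i)) xs)" by (simp add: xs_def)
    then have "map (\<lambda>i. - int (f i)) xs ! i \<le> map (\<lambda>i. - int (f i)) xs ! Suc i"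
      by (rule sorted_nth_mono) (use that l in auto)
    then show ?thesis using that l by (simp add: \<tau>_def)
  qed
  ultimately show ?thesis by blast
qed

lemma ex_standard_representation_matrix:
  assumes "C \<subseteq> words q n"
  shows "\<exists>M. standard_representation_matrix q n C M"
proof -
  have "finite C" using assms finite_words finite_subset by blast
  then obtain cs where cs: "distinct cs" "set cs = C" using finite_distinct_list by blast
  define M where "M = mat_of_cols n cs"
  have "\<forall>r. \<exists>\<tau>. \<tau> permutes {..<q} \<and>
      (\<forall>i. Suc i < q \<longrightarrow> symbol_count M r (\<tau> (Suc i)) \<le> symbol_count M r (\<tau> i))"
    using ex_sorting_permutation by blast
  then obtain T where T: "\<And>r. T r permutes {..<q}"
    "\<And>r i. Suc i < q \<Longrightarrow> symbol_count M r (T r (Suc i)) \<le> symbol_count M r (T r i)"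
    by metis
  define M' where "M' = mat (dim_row M) (dim_col M) (\<lambda>(r, j). inv_into UNIV (T r) (M $$ (r, j)))"
  have cnt: "symbol_count M' r i = symbol_count M r (T r i)" if "r < dim_row M" for r i
  proof -
    have "{j. j < dim_col M' \<and> M' $$ (r, j) = i} = {j. j < dim_col M \<and> M $$ (r, j) = T r i}"
      using that by (auto simp: M'_def permutes_inverses[OF T(1)[of r]])
    then show ?thesis by (simp add: symbol_count_def)
  qed
  have "symbol_equivalent q M M'"
    unfolding symbol_equivalent_def
  proof (intro conjI allI impI)
    fix r assume r: "r < dim_row M"
    show "\<exists>\<pi>. \<pi> permutes {..<q} \<and> (\<forall>j<dim_col M. M' $$ (r, j) = \<pi> (M $$ (r, j)))"
      using r permutes_inv[OF T(1)[of r]] by (intro exI[of _ "inv_into UNIV (T r)"]) (auto simp: M'_def)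
  qed (auto simp: M'_def)
  moreover have "standard_form q M'"
    unfolding standard_form_def using T(2) cnt by (simp add: M'_def)
  moreover have "representation_matrix n C M"
    unfolding representation_matrix_def M_def using cs by blast
  ultimately show ?thesis unfolding standard_representation_matrix_def by blast
qed

end

theory Submission
  imports Defs
begin

text \<open>Fix a codeword \<open>x\<^sub>0\<close>. The sets \<open>A\<^sub>c\<close> of positions where \<open>c\<close> differs from \<open>x\<^sub>0\<close>, for the other
  \<open>n - 1\<close> codewords \<open>c\<close>, form a \<open>d\<close>-cover-free family on \<open>n\<close> points with \<open>d = t - 1\<close>: no member lies
  in the union of \<open>d\<close> others. Suppose that no member of such a family has a private point. Deleting
  a member together with its points leaves a \<open>(d - 1)\<close>-cover-free family, so by induction on \<open>d\<close>
  all members have fewer than \<open>\<alpha> (2 d - 1)\<close> points. The pairs in \<open>A\<^sub>c\<close> lying in a second member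
  form a graph without a matching of size \<open>|A\<^sub>c| - d\<close>, since such a matching would partition \<open>A\<^sub>c\<close>
  into \<open>d\<close> covered parts; by the Erdos-Gallai theorem \<open>A\<^sub>c\<close> then has more than \<open>n / 2\<close> pairs of its
  own, and counting pairs shows that there are fewer than \<open>n - 1\<close> members. Hence private points
  exist, and removing them one by one, every codeword \<open>c \<noteq> x\<^sub>0\<close> has a position where it alone
  differs from all others. Varying \<open>x\<^sub>0\<close> gives this for every codeword.\<close>

section \<open>The Erdos-Gallai bound on graphs with small matching number\<close>

definition matching :: "'a set set \<Rightarrow> bool" where
  "matching M \<longleftrightarrow> finite M \<and> (\<forall>e\<in>M. card e = 2) \<and> (\<forall>e\<in>M. \<forall>f\<in>M. e \<inter> f \<noteq> {} \<longrightarrow> e = f)"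

lemma card_Union_matching:
  assumes "matching M"
  shows "card (\<Union>M) = 2 * card M"
proof -
  have "card (\<Union>M) = sum card M"
    using assms by (intro card_Union_disjoint)
      (auto simp: matching_def pairwise_def disjnt_def intro: card_ge_0_finite)
  also have "\<dots> = 2 * card M" using assms by (simp add: matching_def)
  finally show ?thesis .
qed

lemma finite_Union_matching: "matching M \<Longrightarrow> finite (\<Union>M)"
  by (auto simp: matching_def card_2_iff)

lemma matching_eq: "matching M \<Longrightarrow> e \<in> M \<Longrightarrow> f \<in> M \<Longrightarrow> x \<in> e \<Longrightarrow> x \<in> f \<Longrightarrow> e = f"
  by (auto simp: matching_def)

lemma pair_elem_cases:
  assumes "card e = 2" "x \<in> e"
  obtains y where "e = {x, y}" "y \<noteq> x"
  using assms by (auto simp: card_2_iff doubleton_eq_iff)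

lemma matching_subset: "matching M \<Longrightarrow> M' \<subseteq> M \<Longrightarrow> matching M'"
  unfolding matching_def by (simp add: finite_subset[of M' M] subset_iff)

lemma matching_insert:
  assumes "matching M" "card e = 2" "e \<inter> \<Union>M = {}"
  shows "matching (insert e M)"
  unfolding matching_def
proof (intro conjI ballI impI)
  fix f g assume fg: "f \<in> insert e M" "g \<in> insert e M" "f \<inter> g \<noteq> {}"
  then obtain x where "x \<in> f" "x \<in> g" by blast
  then show "f = g" using fg(1,2) assms(3) matching_eq[OF assms(1)] by blast
qed (use assms in \<open>auto simp: matching_def\<close>)

text \<open>Swap edges along the alternating path from a vertex \<open>p\<close> covered by \<open>N\<close> only. The inclusion
  \<open>M' \<subseteq> M \<union> N\<close> allows the induction to undo a swap: \<open>p\<close> can only be covered by its \<open>N\<close>-edge.\<close>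

lemma matching_augment:
  assumes "matching M" "matching N" "card M < card N"
  shows "\<exists>M'. matching M' \<and> M' \<subseteq> M \<union> N \<and> card M' = Suc (card M) \<and> \<Union>M \<subseteq> \<Union>M'"
  using assms
proof (induction "card (N - M)" arbitrary: M rule: less_induct)
  case less
  note M = less.prems(1) and N = less.prems(2)
  have fin: "finite M" "finite N" using M N by (auto simp: matching_def)
  \<comment> \<open>A matching covers twice as many vertices as it has edges, so \<open>N\<close>
    covers a vertex that \<open>M\<close> misses.\<close>
  have "\<not> \<Union>N \<subseteq> \<Union>M"
    using card_mono[OF finite_Union_matching[OF M], of "\<Union>N"] card_Union_matching M N less.prems(3)
    by (metis linorder_not_less mult_less_cancel1 pos2)
  then obtain p e where pe: "p \<in> e" "e \<in> N" "p \<notin> \<Union>M" by blast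
  obtain a where e: "e = {p, a}" "a \<noteq> p"
    using pair_elem_cases[of e p] pe N unfolding matching_def by blast
  have eM: "e \<notin> M" using pe by blast
  have card_e: "card e = 2" using e by simp
  show ?case
  proof (cases "a \<in> \<Union>M")
    case False
    then have "matching (insert e M)" using matching_insert[OF M card_e] pe e by auto
    moreover have "card (insert e M) = Suc (card M)" using eM fin by simp
    ultimately show ?thesis using pe by (intro exI[of _ "insert e M"]) auto
  next
    case True
    then obtain f where f: "f \<in> M" "a \<in> f" by blast
    obtain b where b: "f = {a, b}" "b \<noteq> a"
      using pair_elem_cases[of f a] f M unfolding matching_def by blast
    have bp: "b \<noteq> p" using pe f b by auto
    have fN: "f \<notin> N"
    proof
      assume "f \<in> N"
      then have "e = f" using matching_eq[OF N pe(2)] f(2) e(1) by blast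
      then show False using f(1) eM by simp
    qed
    \<comment> \<open>Trading \<open>f\<close> for \<open>e\<close> keeps the size, gains
      \<open>p\<close>, gives up \<open>b\<close> and brings the matching one edge closer to
      \<open>N\<close>, so the induction applies to \<open>M1\<close>.\<close>
    define M1 where "M1 = insert e (M - {f})"
    have disj: "e \<inter> \<Union>(M - {f}) = {}"
      using matching_eq[OF M f(1) _ f(2)] pe(3) e(1) by blast
    have M1: "matching M1" unfolding M1_def
      by (rule matching_insert[OF matching_subset[OF M] card_e disj]) auto
    have card1: "card M1 = card M"
      using eM card_Suc_Diff1[OF fin(1) f(1)] fin by (simp add: M1_def del: card_Diff_insert)
    have "N - M1 \<subset> N - M" using fN pe eM by (auto simp: M1_def)
    then have "card (N - M1) < card (N - M)" using fin by (intro psubset_card_mono) auto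
    from less.hyps[OF this M1 N] less.prems(3) card1 obtain M2 where
      M2: "matching M2" "M2 \<subseteq> M1 \<union> N" "card M2 = Suc (card M)" "\<Union>M1 \<subseteq> \<Union>M2" by auto
    have Mun: "\<Union>M \<subseteq> insert b (\<Union>M1)" using b e by (auto simp: M1_def)
    show ?thesis
    proof (cases "b \<in> \<Union>M2")
      case True
      then have "\<Union>M \<subseteq> \<Union>M2" using M2(4) Mun by blast
      moreover have "M2 \<subseteq> M \<union> N" using M2(2) pe(2) by (auto simp: M1_def)
      ultimately show ?thesis using M2(1,3) by blast
    next
      case False
      have "p \<in> \<Union>M2" using M2(4) pe by (auto simp: M1_def)
      then obtain g where g: "g \<in> M2" "p \<in> g" by blast
      have "g \<notin> M" using g pe by blast
      then have "g = e" using g M2(2) matching_eq[OF N _ pe(2) g(2) pe(1)] by (auto simp: M1_def)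
      then have eM2: "e \<in> M2" using g by simp
      \<comment> \<open>\<open>f\<close> is put back in place of \<open>e\<close>. This regains
        \<open>b\<close> and loses only \<open>p\<close>, which \<open>M\<close> did not
        cover.\<close>
      define M3 where "M3 = insert f (M2 - {e})"
      have "f \<inter> \<Union>(M2 - {e}) = {}"
        using matching_eq[OF M2(1) eM2, of _ a] False e(1) b(1) by blast
      then have "matching M3" unfolding M3_def
        using matching_insert[OF matching_subset[OF M2(1)], of "M2 - {e}" f] b by auto
      moreover have "f \<notin> M2" using False b by auto
      then have "card M3 = Suc (card M)"
        using M2(1,3) card_Suc_Diff1[OF _ eM2]
        by (simp add: M3_def matching_def del: card_Diff_insert)
      moreover have "M3 \<subseteq> M \<union> N" using M2 f pe by (auto simp: M3_def M1_def)
      moreover have "\<Union>M \<subseteq> \<Union>M3"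
      proof
        fix x assume x: "x \<in> \<Union>M"
        then have "x \<noteq> p" using pe by blast
        have "x \<in> insert b (\<Union>M2)" using x Mun M2(4) by blast
        then show "x \<in> \<Union>M3" using \<open>x \<noteq> p\<close> b e by (auto simp: M3_def)
      qed
      ultimately show ?thesis by blast
    qed
  qed
qed

section \<open>Maximum matchings and the number of edges\<close>

definition max_matching :: "'a set set \<Rightarrow> 'a set set \<Rightarrow> bool" where
  "max_matching E M \<longleftrightarrow> matching M \<and> M \<subseteq> E \<and> (\<forall>N. matching N \<and> N \<subseteq> E \<longrightarrow> card N \<le> card M)"

lemma ex_max_matching:
  assumes "finite E"
  shows "\<exists>M. max_matching E M"
proof -
  have "matching {} \<and> {} \<subseteq> E" by (simp add: matching_def)
  moreover have "\<forall>N. matching N \<and> N \<subseteq> E \<longrightarrow> card N < Suc (card E)"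
    using assms by (simp add: card_mono less_Suc_eq_le)
  ultimately show ?thesis
    using ex_has_greatest_nat[of "\<lambda>N. matching N \<and> N \<subseteq> E" "{}" card "Suc (card E)"]
    unfolding max_matching_def by blast
qed

text \<open>If \<open>uv\<close> is the edge of \<open>M\<close> at \<open>u\<close>, enlarging \<open>M - uv\<close> by means of \<open>N\<close> covers only two new vertices,
  hence misses one of \<open>v\<close>, \<open>x\<close>, \<open>y\<close>, to which \<open>u\<close> could be joined.\<close>

lemma max_matching_essential:
  assumes M: "max_matching E M" and E: "\<forall>e\<in>E. card e = 2"
    and x: "{u, x} \<in> E" "x \<notin> \<Union>M" and y: "{u, y} \<in> E" "y \<notin> \<Union>M" and "x \<noteq> y"
    and N: "matching N" "N \<subseteq> E" "u \<notin> \<Union>N"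
  shows "card N < card M"
proof (rule ccontr)
  assume "\<not> card N < card M"
  have mM: "matching M" "M \<subseteq> E" and max: "\<And>K. matching K \<Longrightarrow> K \<subseteq> E \<Longrightarrow> card K \<le> card M"
    using M by (auto simp: max_matching_def)
  have no_ext: False if "matching K" "K \<subseteq> E" "card K = card M" "e \<in> E" "e \<inter> \<Union>K = {}" for K e
  proof -
    have "card e = 2" using E that by blast
    then have "matching (insert e K)" using matching_insert that by blast
    moreover have "e \<notin> K" using that(5) \<open>card e = 2\<close> by (cases "e = {}") auto
    moreover have "finite K" using that by (simp add: matching_def)
    ultimately show False using max[of "insert e K"] that by simp
  qed
  have "u \<in> \<Union>M" using no_ext[OF mM refl x(1)] x by blast
  then obtain f where f: "f \<in> M" "u \<in> f" by blast
  obtain v where v: "f = {u, v}" "v \<noteq> u"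
    using pair_elem_cases[of f u] f mM unfolding matching_def by blast
  define K where "K = M - {f}"
  have K: "matching K" using matching_subset[OF mM(1)] by (simp add: K_def)
  have fin: "finite M" using mM by (simp add: matching_def)
  have cK: "Suc (card K) = card M" using card_Suc_Diff1[OF fin f(1)] by (simp add: K_def del: card_Diff_insert)
  have uK: "u \<notin> \<Union>K" "v \<notin> \<Union>K"
    using matching_eq[OF mM(1) f(1)] v(1) unfolding K_def by blast+
  from matching_augment[OF K N(1)] cK \<open>\<not> card N < card M\<close> obtain L where
    L: "matching L" "L \<subseteq> K \<union> N" "card L = card M" "\<Union>K \<subseteq> \<Union>L" by auto
  have LE: "L \<subseteq> E" using L mM N by (auto simp: K_def)
  have uL: "u \<notin> \<Union>L" using L(2) uK N(3) by blast
  have xy: "x \<in> \<Union>L" "y \<in> \<Union>L"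
    using no_ext[OF L(1) LE L(3) x(1)] no_ext[OF L(1) LE L(3) y(1)] uL by blast+
  have vL: "v \<in> \<Union>L" using no_ext[OF L(1) LE L(3), of f] f mM uL v by blast
  have vM: "v \<in> \<Union>M" using f v by blast
  have xyK: "x \<notin> \<Union>K" "y \<notin> \<Union>K" using x y by (auto simp: K_def)
  \<comment> \<open>\<open>L\<close> has one edge more than \<open>K\<close>, so it covers two more
    vertices: too few for \<open>x\<close>, \<open>y\<close> and \<open>v\<close>.\<close>
  have "insert x (insert y (insert v (\<Union>K))) \<subseteq> \<Union>L" using xy vL L(4) by blast
  then have "card (insert x (insert y (insert v (\<Union>K)))) \<le> card (\<Union>L)"
    by (rule card_mono[OF finite_Union_matching[OF L(1)]])
  moreover have "card (insert x (insert y (insert v (\<Union>K)))) = 3 + card (\<Union>K)"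
  proof -
    have "x \<noteq> v" "y \<noteq> v" using x(2) y(2) vM by metis+
    then show ?thesis using finite_Union_matching[OF K] xyK uK \<open>x \<noteq> y\<close>
      by (simp del: Union_iff)
  qed
  ultimately show False using card_Union_matching[OF L(1)] card_Union_matching[OF K] L(3) cK by simp
qed

text \<open>Doubled and over the integers, so that later estimates meet neither division nor
  truncated subtraction.\<close>

lemma card_pairs:
  assumes "finite V"
  shows "2 * int (card {e. e \<subseteq> V \<and> card e = 2}) = int (card V) * (int (card V) - 1)"
proof -
  have "even (card V * (card V - 1))" by (cases "card V") auto
  then have "2 * (card V choose 2) = card V * (card V - 1)"
    by (simp add: choose_two)
  then show ?thesis using n_subsets[OF assms, of 2]
    by (cases "card V") (auto simp: algebra_simps simp flip: of_nat_mult)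
qed

text \<open>\<open>h\<close> counts the deleted vertices that lie in every maximum matching; what remains has no more
  edges than a clique on \<open>2 g + 1\<close> vertices.\<close>

lemma erdos_gallai:
  fixes V :: "'a set"
  assumes "finite V" "E \<subseteq> {e. e \<subseteq> V \<and> card e = 2}" "max_matching E M"
  shows "\<exists>h g. h + g \<le> card M \<and> 2 * int (card E) \<le>
    int (card V) * (int (card V) - 1) - (int (card V) - int h) * (int (card V) - int h - 1)
      + 2 * int g * (2 * int g + 1)"
  using assms
proof (induction "card M" arbitrary: V E M rule: less_induct)
  case less
  note V = less.prems(1) and E = less.prems(2) and M = less.prems(3)
  have finE: "finite E" using V E by (auto intro: finite_subset[of _ "Pow V"])
  have mM: "matching M" "M \<subseteq> E" and max: "\<And>K. matching K \<Longrightarrow> K \<subseteq> E \<Longrightarrow> card K \<le> card M"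
    using M by (auto simp: max_matching_def)
  have E2: "\<forall>e\<in>E. card e = 2" using E by auto
  show ?case
  proof (cases "\<exists>u x y. {u, x} \<in> E \<and> x \<notin> \<Union>M \<and> {u, y} \<in> E \<and> y \<notin> \<Union>M \<and> x \<noteq> y")
    case True
    then obtain u x y where u: "{u, x} \<in> E" "x \<notin> \<Union>M" "{u, y} \<in> E" "y \<notin> \<Union>M" "x \<noteq> y" by blast
    have uV: "u \<in> V" using u E by auto
    define E' where "E' = {e\<in>E. u \<notin> e}"
    have "finite E'" using finE by (simp add: E'_def)
    then obtain M' where M': "max_matching E' M'" using ex_max_matching by blast
    \<comment> \<open>Every matching that avoids \<open>u\<close> is smaller than \<open>M\<close>,
      so \<open>u\<close> can be deleted and counted in \<open>h\<close>.\<close>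
    have lt: "card M' < card M"
      using max_matching_essential[OF M E2 u, of M'] M' by (auto simp: max_matching_def E'_def)
    have E'V: "E' \<subseteq> {e. e \<subseteq> V - {u} \<and> card e = 2}" using E by (auto simp: E'_def)
    from less.hyps[OF lt _ E'V M'] V obtain h g where hg: "h + g \<le> card M'"
      "2 * int (card E') \<le> int (card (V - {u})) * (int (card (V - {u})) - 1)
        - (int (card (V - {u})) - int h) * (int (card (V - {u})) - int h - 1) + 2 * int g * (2 * int g + 1)"
      by auto
    have cV: "int (card (V - {u})) = int (card V) - 1"
      using V uV by (metis card_Suc_Diff1 diff_add_cancel of_nat_Suc add.commute add_diff_cancel_left')
    have "E \<subseteq> E' \<union> (\<lambda>w. {u, w}) ` (V - {u})"
    proof
      fix e assume e: "e \<in> E"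
      show "e \<in> E' \<union> (\<lambda>w. {u, w}) ` (V - {u})"
      proof (cases "u \<in> e")
        case True
        obtain w where "e = {u, w}" "w \<noteq> u"
          using pair_elem_cases[of e u] True e E2 by blast
        then show ?thesis using e E by auto
      qed (use e in \<open>simp add: E'_def\<close>)
    qed
    then have "card E \<le> card (E' \<union> (\<lambda>w. {u, w}) ` (V - {u}))"
      using \<open>finite E'\<close> V by (intro card_mono) auto
    also have "\<dots> \<le> card E' + card (V - {u})"
      using card_Un_le card_image_le V by (metis add_left_mono finite_Diff le_trans)
    finally have "2 * int (card E) \<le> 2 * int (card E') + 2 * (int (card V) - 1)" using cV by simp
    then have "2 * int (card E) \<le>
      int (card V) * (int (card V) - 1) - (int (card V) - int (Suc h)) * (int (card V) - int (Suc h) - 1)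
      + 2 * int g * (2 * int g + 1)"
      using hg(2) unfolding cV by (simp add: algebra_simps)
    moreover have "Suc h + g \<le> card M" using hg lt by simp
    ultimately show ?thesis by blast
  next
    case False
    define W where "W = \<Union>M"
    have finW: "finite W" and cW: "card W = 2 * card M"
      using finite_Union_matching card_Union_matching mM by (auto simp: W_def)
    \<comment> \<open>Every edge meets \<open>W\<close> by maximality. No vertex has two neighbours
      outside \<open>W\<close>, so each \<open>w\<close> in \<open>W\<close> lies on at most one
      edge leaving \<open>W\<close>, which \<open>THE\<close> picks out.\<close>
    have "E \<subseteq> {e. e \<subseteq> W \<and> card e = 2} \<union> (\<lambda>w. THE e. e \<in> E \<and> w \<in> e \<and> \<not> e \<subseteq> W) ` W"
    proof
      fix e assume e: "e \<in> E"
      show "e \<in> {e. e \<subseteq> W \<and> card e = 2} \<union> (\<lambda>w. THE e. e \<in> E \<and> w \<in> e \<and> \<not> e \<subseteq> W) ` W"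
      proof (cases "e \<subseteq> W")
        case F: False
        have "e \<inter> W \<noteq> {}"
        proof
          assume "e \<inter> W = {}"
          then have "matching (insert e M)" "e \<notin> M"
            using matching_insert[OF mM(1)] e E2 F by (auto simp: W_def)
          then show False using max[of "insert e M"] mM e by (auto simp: matching_def)
        qed
        then obtain w where w: "w \<in> e" "w \<in> W" by blast
        have "(THE e. e \<in> E \<and> w \<in> e \<and> \<not> e \<subseteq> W) = e"
        proof (rule the_equality)
          show "e \<in> E \<and> w \<in> e \<and> \<not> e \<subseteq> W" using e w F by simp
          fix f assume f: "f \<in> E \<and> w \<in> f \<and> \<not> f \<subseteq> W"
          obtain x where x: "e = {w, x}"
            using pair_elem_cases[of e w] w e E2 by blast
          obtain y where y: "f = {w, y}"
            using pair_elem_cases[of f w] f E2 by blast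
          show "f = e" using False x y e f F w unfolding W_def by blast
        qed
        then have "e \<in> (\<lambda>w. THE e. e \<in> E \<and> w \<in> e \<and> \<not> e \<subseteq> W) ` W"
          using w(2) by (intro image_eqI[of _ _ w]) simp_all
        then show ?thesis by (rule UnI2)
      qed (use e E2 in auto)
    qed
    then have "card E \<le> card ({e. e \<subseteq> W \<and> card e = 2} \<union> (\<lambda>w. THE e. e \<in> E \<and> w \<in> e \<and> \<not> e \<subseteq> W) ` W)"
      using finW by (intro card_mono) auto
    also have "\<dots> \<le> card {e. e \<subseteq> W \<and> card e = 2} + card W"
      using card_Un_le card_image_le finW by (metis (no_types, lifting) add_left_mono le_trans)
    finally have "2 * int (card E) \<le> 2 * int (card {e. e \<subseteq> W \<and> card e = 2}) + 2 * int (card W)" by simp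
    \<comment> \<open>With \<open>m\<close> for \<open>card M\<close>, the
      \<open>m * (2 * m - 1)\<close> pairs inside \<open>W\<close> and at most \<open>2 * m\<close>
      leaving edges add up to a clique on \<open>2 * m + 1\<close> vertices; hence
      \<open>h = 0\<close> and \<open>g = m\<close>.\<close>
    then have "2 * int (card E) \<le> 2 * int (card M) * (2 * int (card M) + 1)"
      unfolding card_pairs[OF finW] cW by (simp add: algebra_simps)
    then show ?thesis by (intro exI[of _ 0] exI[of _ "card M"]) simp
  qed
qed

section \<open>Cover-free families\<close>

text \<open>Indexing the members keeps their number unchanged when a set is subtracted from all of
  them.\<close>

definition cover_free :: "nat \<Rightarrow> 'i set \<Rightarrow> ('i \<Rightarrow> 'a set) \<Rightarrow> bool" where
  "cover_free d I A \<longleftrightarrow> (\<forall>c\<in>I. \<forall>J\<subseteq>I - {c}. card J \<le> d \<longrightarrow> \<not> A c \<subseteq> \<Union>(A ` J))"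

definition private_point :: "'i set \<Rightarrow> ('i \<Rightarrow> 'a set) \<Rightarrow> 'i \<Rightarrow> 'a \<Rightarrow> bool" where
  "private_point I A c x \<longleftrightarrow> x \<in> A c \<and> (\<forall>b\<in>I - {c}. x \<notin> A b)"

definition own_pairs :: "'i set \<Rightarrow> ('i \<Rightarrow> 'a set) \<Rightarrow> 'i \<Rightarrow> 'a set set" where
  "own_pairs I A c = {e. e \<subseteq> A c \<and> card e = 2 \<and> (\<forall>b\<in>I - {c}. \<not> e \<subseteq> A b)}"

text \<open>Choosing for each part another member that contains it yields a cover of
  \<open>A c\<close> by at most \<open>card P\<close> members.\<close>

lemma cover_free_parts:
  assumes "cover_free d I A" "c \<in> I" "finite P" "\<forall>p\<in>P. \<exists>b\<in>I - {c}. p \<subseteq> A b" "A c \<subseteq> \<Union>P"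
  shows "d < card P"
proof (rule ccontr)
  assume "\<not> d < card P"
  obtain f where f: "\<forall>p\<in>P. f p \<in> I - {c} \<and> p \<subseteq> A (f p)" using assms(4) by metis
  have "card (f ` P) \<le> d" using \<open>\<not> d < card P\<close> card_image_le[OF assms(3), of f] by linarith
  moreover have "\<Union>P \<subseteq> \<Union>(A ` (f ` P))"
  proof
    fix x assume "x \<in> \<Union>P"
    then obtain p where "p \<in> P" "x \<in> p" by blast
    moreover from this have "x \<in> A (f p)" using f by blast
    ultimately show "x \<in> \<Union>(A ` (f ` P))" by blast
  qed
  then have "A c \<subseteq> \<Union>(A ` (f ` P))" using assms(5) by (rule order_trans[rotated])
  moreover have "f ` P \<subseteq> I - {c}" using f by blast
  ultimately show False using assms(1,2) unfolding cover_free_def by blast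
qed

text \<open>Without private points, every point of \<open>A c\<close> lies in another member. For a
  maximum matching \<open>M\<close> of the pairs that are not own, its edges and the leftover
  singletons are \<open>card (A c) - card M\<close> parts covering \<open>A c\<close>, so
  \<open>card M + d < card (A c)\<close>. A graph with such a matching number has few edges, which
  leaves many own pairs.\<close>

lemma own_pairs_bound:
  assumes cf: "cover_free d I A" and c: "c \<in> I" and fin: "finite (A c)"
    and np: "\<not> (\<exists>x. private_point I A c x)"
  shows "d < card (A c)"
    and "\<exists>g. g + d < card (A c) \<and>
      (int d + 1 + int g) * (int d + int g) - 2 * int g * (2 * int g + 1) \<le> 2 * int (card (own_pairs I A c))"
proof -
  have cov: "\<exists>b\<in>I - {c}. {x} \<subseteq> A b" if "x \<in> A c" for x
    using np that unfolding private_point_def by blast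
  let ?k = "card (A c)"
  have "d < card ((\<lambda>x. {x}) ` A c)"
    using cover_free_parts[OF cf c, of "(\<lambda>x. {x}) ` A c"] fin cov by auto
  then show k: "d < ?k" by (simp add: card_image)
  define E where "E = {e. e \<subseteq> A c \<and> card e = 2} - own_pairs I A c"
  have finp: "finite {e. e \<subseteq> A c \<and> card e = 2}" using fin by simp
  have "finite E" unfolding E_def using finp by simp
  then obtain M where M: "max_matching E M" using ex_max_matching by blast
  have mM: "matching M" "M \<subseteq> E" using M by (auto simp: max_matching_def)
  have finM: "finite M" using mM by (simp add: matching_def)
  define P where "P = M \<union> (\<lambda>x. {x}) ` (A c - \<Union>M)"
  have MA: "\<Union>M \<subseteq> A c" using mM by (auto simp: E_def)
  have "card P \<le> card M + card (A c - \<Union>M)"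
    unfolding P_def using card_Un_le card_image_le fin by (metis add_left_mono finite_Diff le_trans)
  also have "card (A c - \<Union>M) = ?k - 2 * card M"
    using card_Diff_subset[OF finite_Union_matching[OF mM(1)] MA] card_Union_matching[OF mM(1)] by simp
  finally have cP: "card P \<le> card M + (?k - 2 * card M)" .
  have "2 * card M \<le> ?k" using card_mono[OF fin MA] card_Union_matching[OF mM(1)] by simp
  moreover have "d < card P"
  proof (rule cover_free_parts[OF cf c])
    show "finite P" using finM fin by (simp add: P_def)
    show "A c \<subseteq> \<Union>P" by (auto simp: P_def)
    show "\<forall>p\<in>P. \<exists>b\<in>I - {c}. p \<subseteq> A b"
    proof
      fix p assume "p \<in> P"
      then consider "p \<in> M" | x where "x \<in> A c" "p = {x}" by (auto simp: P_def)
      then show "\<exists>b\<in>I - {c}. p \<subseteq> A b"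
      proof cases
        case 1
        then have "p \<in> E" using mM by blast
        then show ?thesis by (auto simp: E_def own_pairs_def)
      qed (use cov in blast)
    qed
  qed
  ultimately have mk: "card M + d < ?k" using cP by linarith
  have "E \<subseteq> {e. e \<subseteq> A c \<and> card e = 2}" by (auto simp: E_def)
  from erdos_gallai[OF fin this M] obtain h g where hg: "h + g \<le> card M"
    "2 * int (card E) \<le> int ?k * (int ?k - 1) - (int ?k - int h) * (int ?k - int h - 1)
      + 2 * int g * (2 * int g + 1)" by blast
  have own: "own_pairs I A c \<subseteq> {e. e \<subseteq> A c \<and> card e = 2}" by (auto simp: own_pairs_def)
  have "card E = card {e. e \<subseteq> A c \<and> card e = 2} - card (own_pairs I A c)"
    unfolding E_def using finite_subset[OF own finp] own by (rule card_Diff_subset)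
  moreover have "card (own_pairs I A c) \<le> card {e. e \<subseteq> A c \<and> card e = 2}"
    using finp own by (rule card_mono)
  ultimately have "2 * int (card (own_pairs I A c)) = int ?k * (int ?k - 1) - 2 * int (card E)"
    using card_pairs[OF fin] by linarith
  then have "(int ?k - int h) * (int ?k - int h - 1) - 2 * int g * (2 * int g + 1)
      \<le> 2 * int (card (own_pairs I A c))" using hg(2) by linarith
  \<comment> \<open>Since \<open>h + g\<close> is at most \<open>card M\<close>,
    \<open>card (A c) - h\<close> is at least \<open>d + 1 + g\<close>; this eliminates
    \<open>h\<close> and \<open>card (A c)\<close>.\<close>
  moreover have "(int d + 1 + int g) * (int d + int g) \<le> (int ?k - int h) * (int ?k - int h - 1)"
    using mk hg(1) by (intro mult_mono) auto
  moreover have "g + d < ?k" using mk hg(1) by linarith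
  ultimately show "\<exists>g. g + d < ?k \<and>
      (int d + 1 + int g) * (int d + int g) - 2 * int g * (2 * int g + 1) \<le> 2 * int (card (own_pairs I A c))"
    by (intro exI[of _ g]) linarith
qed

text \<open>The constant is the larger root of \<open>12 z\<^sup>2 - 15 z + 4\<close>, for which the minimum of the quadratic
  at the right end of the admissible range of \<open>g\<close> has leading term exactly \<open>\<alpha> d\<^sup>2\<close>.\<close>

definition alpha :: real where "alpha = (15 + sqrt 33) / 24"

lemma alpha_quadratic: "12 * alpha\<^sup>2 = 15 * alpha - 4"
  by (simp add: alpha_def power2_eq_square field_simps)

lemma alpha_bounds: "864/1000 < alpha" "alpha < 865/1000"
proof -
  have "5.744 < sqrt 33" by (rule real_less_rsqrt) (simp add: power2_eq_square)
  moreover have "sqrt 33 < 5.745" by (rule real_less_lsqrt) (simp_all add: power2_eq_square)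
  ultimately show "864/1000 < alpha" "alpha < 865/1000" by (simp_all add: alpha_def)
qed

text \<open>The right-hand side is \<open>d\<^sup>2 + d + g * (2 * d - 1 - 3 * g)\<close>. It is
  concave in \<open>g\<close>, so only the ends of the range matter. At \<open>g = 0\<close> the
  term \<open>d\<^sup>2 + d\<close> suffices; the right end uses the quadratic equation of
  \<open>alpha\<close>.\<close>

lemma alpha_own_pairs:
  fixes d g :: real
  assumes g: "0 \<le> g" "g < alpha * (2 * d - 1) - d - 1"
  shows "alpha * d\<^sup>2 < (d + 1 + g) * (d + g) - 2 * g * (2 * g + 1)"
proof -
  define G where "G = alpha * (2 * d - 1) - d - 1"
  have "0 < (2 * alpha - 1) * d - (alpha + 1)" using g by (simp add: algebra_simps)
  then have "alpha + 1 < (2 * alpha - 1) * d" by simp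
  \<comment> \<open>The range of \<open>g\<close> is nonempty only if \<open>d\<close> exceeds
    \<open>(alpha + 1) / (2 * alpha - 1)\<close>, which is above 5/2.\<close>
  have d: "5/2 < d"
  proof (rule ccontr)
    assume "\<not> 5/2 < d"
    then have "(2 * alpha - 1) * d \<le> (2 * alpha - 1) * (5/2)"
      using alpha_bounds by (intro mult_left_mono) auto
    then show False using \<open>alpha + 1 < (2 * alpha - 1) * d\<close> alpha_bounds by (simp add: algebra_simps)
  qed
  have lhs: "(d + 1 + g) * (d + g) - 2 * g * (2 * g + 1) = d\<^sup>2 + d + g * (2 * d - 1 - 3 * g)"
    by (simp add: algebra_simps power2_eq_square)
  have small: "alpha * d\<^sup>2 < d\<^sup>2 + d"
  proof -
    have "alpha * d\<^sup>2 \<le> 1 * d\<^sup>2" using alpha_bounds by (intro mult_right_mono) auto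
    then show ?thesis using d by linarith
  qed
  show ?thesis
  proof (cases "3 * g \<le> 2 * d - 1")
    case True
    then have "0 \<le> g * (2 * d - 1 - 3 * g)" using g by simp
    then show ?thesis using lhs small by linarith
  next
    case False
    have gG: "g \<le> G" using g by (simp add: G_def)
    have "g * (3 * g - (2 * d - 1)) \<le> G * (3 * G - (2 * d - 1))"
      using gG g False by (intro mult_mono) auto
    then have *: "G * (2 * d - 1 - 3 * G) \<le> g * (2 * d - 1 - 3 * g)" by (simp add: algebra_simps)
    \<comment> \<open>The factor 4 makes the square of \<open>G\<close> appear with coefficient 12,
      so the equation of \<open>alpha\<close> removes \<open>alpha\<^sup>2\<close>. The terms
      quadratic in \<open>d\<close> collapse to \<open>4 * (alpha * d\<^sup>2)\<close>, and the
      linear remainder is positive for \<open>d > 5/2\<close>.\<close>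
    have "4 * (d\<^sup>2 + d + G * (2 * d - 1 - 3 * G)) = 4 * d\<^sup>2 + 4 * d + 4 * (G * (2 * d - 1)) - 12 * G\<^sup>2"
      by (simp add: algebra_simps power2_eq_square)
    also have "12 * G\<^sup>2 = (12 * alpha\<^sup>2) * (2 * d - 1)\<^sup>2 - 24 * alpha * (2 * d - 1) * (d + 1) + 12 * (d + 1)\<^sup>2"
      by (simp add: G_def algebra_simps power2_eq_square)
    also have "4 * d\<^sup>2 + 4 * d + 4 * (G * (2 * d - 1)) - ((12 * alpha\<^sup>2) * (2 * d - 1)\<^sup>2
        - 24 * alpha * (2 * d - 1) * (d + 1) + 12 * (d + 1)\<^sup>2)
      = 4 * (alpha * d\<^sup>2) + alpha * (68 * d - 35) - 40 * d - 4"
      unfolding alpha_quadratic by (simp add: G_def algebra_simps power2_eq_square)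
    finally have "4 * (d\<^sup>2 + d + G * (2 * d - 1 - 3 * G))
      = 4 * (alpha * d\<^sup>2) + alpha * (68 * d - 35) - 40 * d - 4" .
    moreover have "864/1000 * (68 * d - 35) \<le> alpha * (68 * d - 35)"
      using d alpha_bounds by (intro mult_right_mono) auto
    moreover have "v < u" if "4 * u = 4 * v + w - 40 * d - 4" "864/1000 * (68 * d - 35) \<le> w" for u v w
      using that d by (simp add: field_simps)
    ultimately have "alpha * d\<^sup>2 < d\<^sup>2 + d + G * (2 * d - 1 - 3 * G)" by blast
    then show ?thesis using lhs * by linarith
  qed
qed

section \<open>Counting members and finding private points\<close>

lemma cover_freeD:
  assumes "cover_free d I A" "c \<in> I" "J \<subseteq> I - {c}" "card J \<le> d"
  shows "\<exists>x\<in>A c. \<forall>b\<in>J. x \<notin> A b"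
proof -
  have "\<not> A c \<subseteq> \<Union>(A ` J)" using assms unfolding cover_free_def by simp
  then show ?thesis by blast
qed

lemma cover_free_remove:
  assumes "cover_free d I A"
  shows "cover_free d (I - {c}) A"
  unfolding cover_free_def
proof (intro ballI allI impI)
  fix b J assume "b \<in> I - {c}" "J \<subseteq> I - {c} - {b}" "card J \<le> d"
  then have "\<exists>x\<in>A b. \<forall>a\<in>J. x \<notin> A a" by (intro cover_freeD[OF assms]) auto
  then show "\<not> A b \<subseteq> \<Union>(A ` J)" by blast
qed

text \<open>If \<open>d\<close> other members cover \<open>A b\<close> outside \<open>A c\<close>,
  then together with \<open>c\<close> they cover all of \<open>A b\<close>.\<close>

lemma cover_free_link:
  assumes cf: "cover_free (Suc d) I A" and c: "c \<in> I"
  shows "cover_free d (I - {c}) (\<lambda>b. A b - A c)"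
  unfolding cover_free_def
proof (intro ballI allI impI notI)
  fix b J assume b: "b \<in> I - {c}" and J: "J \<subseteq> I - {c} - {b}" "card J \<le> d"
    and sub: "A b - A c \<subseteq> (\<Union>a\<in>J. A a - A c)"
  have "card (insert c J) \<le> Suc d" using J(2) card_insert_le_m1[of "Suc d" J c] by simp
  moreover have "insert c J \<subseteq> I - {b}" using b c J by blast
  moreover have "A b \<subseteq> \<Union>(A ` insert c J)" using sub by auto
  ultimately show False using cover_freeD[OF cf, of b "insert c J"] b by blast
qed

text \<open>A pair owned by one member is contained in no other, so the own pairs of different
  members are distinct pairs of points of \<open>R\<close>.\<close>

lemma card_own_pairs_sum:
  assumes "finite I" "finite R" "\<forall>c\<in>I. A c \<subseteq> R"
  shows "(\<Sum>c\<in>I. 2 * int (card (own_pairs I A c))) \<le> int (card R) * (int (card R) - 1)"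
proof -
  have sub: "(\<Union>c\<in>I. own_pairs I A c) \<subseteq> {e. e \<subseteq> R \<and> card e = 2}"
    using assms(3) by (auto simp: own_pairs_def)
  have fin: "finite {e. e \<subseteq> R \<and> card e = 2}" using assms(2) by simp
  have "own_pairs I A b \<inter> own_pairs I A c = {}" if "b \<in> I" "c \<in> I" "b \<noteq> c" for b c
    using that by (auto simp: own_pairs_def)
  then have "(\<Sum>c\<in>I. card (own_pairs I A c)) = card (\<Union>c\<in>I. own_pairs I A c)"
    using finite_subset[OF sub fin] assms(1) by (intro card_UN_disjoint[symmetric]) auto
  also have "\<dots> \<le> card {e. e \<subseteq> R \<and> card e = 2}" by (rule card_mono[OF fin sub])
  finally have "int (\<Sum>c\<in>I. card (own_pairs I A c)) \<le> int (card {e. e \<subseteq> R \<and> card e = 2})"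
    by (rule of_nat_mono)
  then show ?thesis using card_pairs[OF assms(2)] by (simp flip: sum_distrib_left)
qed

text \<open>If some member is large, the link at it is counted by the assumption
  \<open>link\<close>, which is supplied by induction in one application and by the finished bound
  in the other. If all members are small, each owns more than \<open>card R / 2\<close> pairs, and
  double counting pairs bounds their number.\<close>

lemma no_private_card_less:
  fixes A :: "'i \<Rightarrow> 'a set"
  assumes cf: "cover_free d I A" and I: "finite I" "I \<noteq> {}" and R: "finite R" "\<forall>c\<in>I. A c \<subseteq> R"
    and N: "real (card R) < alpha * (real d)\<^sup>2"
    and np: "\<forall>c\<in>I. \<not> (\<exists>x. private_point I A c x)"
    and link: "\<And>c. c \<in> I \<Longrightarrow> real (card (R - A c)) < alpha * (real d - 1)\<^sup>2 \<Longrightarrow>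
      card (I - {c}) \<le> card (R - A c)"
  shows "card I + 1 < card R"
proof -
  have finA: "finite (A c)" if "c \<in> I" for c using R that finite_subset by blast
  have w_le: "card (A c) \<le> card R" if "c \<in> I" for c using R that card_mono by blast
  have w_gt: "d < card (A c)" if "c \<in> I" for c
    using own_pairs_bound(1)[OF cf that finA[OF that]] np that by blast
  obtain c0 where c0: "c0 \<in> I" using I by blast
  have dN: "d < card R" using w_gt[OF c0] w_le[OF c0] by simp
  \<comment> \<open>\<open>d < card R < alpha * d\<^sup>2\<close> with \<open>alpha < 1\<close> is
    impossible for \<open>d\<close> at most 1.\<close>
  have "d \<noteq> 0" using N by (cases "d = 0") auto
  moreover have "d \<noteq> 1" using N dN alpha_bounds by (cases "d = 1") auto
  ultimately have d2: "2 \<le> d" by linarith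
  show ?thesis
  proof (cases "\<exists>c\<in>I. alpha * (2 * real d - 1) \<le> real (card (A c))")
    case True
    then obtain c where c: "c \<in> I" "alpha * (2 * real d - 1) \<le> real (card (A c))" by blast
    have cD: "card (R - A c) = card R - card (A c)"
      using R c(1) finA by (simp add: card_Diff_subset)
    \<comment> \<open>The size threshold is exactly the difference between the bounds for
      \<open>d\<close> and \<open>d - 1\<close>.\<close>
    have "alpha * (real d)\<^sup>2 - alpha * (2 * real d - 1) = alpha * (real d - 1)\<^sup>2"
      by (simp add: power2_eq_square algebra_simps)
    then have "real (card (R - A c)) < alpha * (real d - 1)\<^sup>2"
      using N c w_le[OF c(1)] cD by linarith
    from link[OF c(1) this] have "card I - 1 \<le> card R - card (A c)" using I c cD by simp
    then show ?thesis using w_gt[OF c(1)] w_le[OF c(1)] d2 by linarith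
  next
    case False
    have own: "int (card R) + 1 \<le> 2 * int (card (own_pairs I A c))" if c: "c \<in> I" for c
    proof -
      obtain g where g: "g + d < card (A c)" "(int d + 1 + int g) * (int d + int g)
          - 2 * int g * (2 * int g + 1) \<le> 2 * int (card (own_pairs I A c))"
        using own_pairs_bound(2)[OF cf c finA[OF c]] np c by blast
      have "real (card (A c)) < alpha * (2 * real d - 1)" using False c by force
      then have "real g < alpha * (2 * real d - 1) - real d - 1" using g(1) by linarith
      then have *: "alpha * (real d)\<^sup>2 < (real d + 1 + real g) * (real d + real g)
          - 2 * real g * (2 * real g + 1)"
        by (intro alpha_own_pairs) simp_all
      have "real_of_int ((int d + 1 + int g) * (int d + int g) - 2 * int g * (2 * int g + 1))
          \<le> real_of_int (2 * int (card (own_pairs I A c)))"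
        using g(2) by (rule of_int_le_iff[THEN iffD2])
      then have "real (card R) < real_of_int (2 * int (card (own_pairs I A c)))"
        using * N by simp
      then show ?thesis by linarith
    qed
    have "int (card I) * (int (card R) + 1) = (\<Sum>c\<in>I. int (card R) + 1)" by simp
    also have "\<dots> \<le> (\<Sum>c\<in>I. 2 * int (card (own_pairs I A c)))" using own by (intro sum_mono) auto
    also have "\<dots> \<le> int (card R) * (int (card R) - 1)" by (rule card_own_pairs_sum[OF I(1) R])
    finally have le: "int (card I) * (int (card R) + 1) \<le> int (card R) * (int (card R) - 1)" .
    show ?thesis
    proof (rule ccontr)
      assume "\<not> card I + 1 < card R"
      then have "(int (card R) - 1) * (int (card R) + 1) \<le> int (card I) * (int (card R) + 1)"
        by (intro mult_right_mono) auto
      with le have "(int (card R) - 1) * (int (card R) + 1) \<le> int (card R) * (int (card R) - 1)"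
        by linarith
      then show False using dN d2 by (simp add: algebra_simps)
    qed
  qed
qed

text \<open>The inner induction on \<open>card I\<close> removes a member together with a private
  point. When there is none, the outer induction on \<open>d\<close> bounds the links.\<close>

theorem cover_free_card_le:
  assumes "cover_free d I A" "finite I" "finite R" "\<forall>c\<in>I. A c \<subseteq> R"
    and "real (card R) < alpha * (real d)\<^sup>2"
  shows "card I \<le> card R"
  using assms
proof (induction d arbitrary: I A R)
  case 0
  then show ?case by simp
next
  case (Suc d)
  note outer = Suc.IH
  from Suc.prems show ?case
  proof (induction "card I" arbitrary: I R rule: less_induct)
    case less
    note cf = less.prems(1) and I = less.prems(2) and R = less.prems(3,4) and N = less.prems(5)
    show ?case
    proof (cases "\<exists>c\<in>I. \<exists>x. private_point I A c x")
      case True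
      then obtain c x where cx: "c \<in> I" "private_point I A c x" by blast
      have x: "x \<in> R" "\<forall>b\<in>I - {c}. A b \<subseteq> R - {x}"
        using cx R(2) by (auto simp: private_point_def)
      have lt: "card (I - {c}) < card I" using I cx by (intro psubset_card_mono) auto
      have lR: "Suc (card (R - {x})) = card R" using card_Suc_Diff1[OF R(1) x(1)] .
      have "real (card (R - {x})) < alpha * (real (Suc d))\<^sup>2" using N lR by linarith
      from less.hyps[OF lt cover_free_remove[OF cf] _ _ x(2) this] I R(1)
      have "card (I - {c}) \<le> card (R - {x})" by simp
      then show ?thesis using lR card_Suc_Diff1[OF I cx(1)] by linarith
    next
      case False
      have link: "card (I - {c}) \<le> card (R - A c)"
        if "c \<in> I" "real (card (R - A c)) < alpha * (real (Suc d) - 1)\<^sup>2" for c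
        using outer[OF cover_free_link[OF cf that(1)], of "R - A c"] that(2) I R by auto
      show ?thesis
      proof (cases "I = {}")
        case False
        then show ?thesis
          using no_private_card_less[OF cf I _ R N _ link] \<open>\<not> (\<exists>c\<in>I. \<exists>x. private_point I A c x)\<close>
          by fastforce
      qed simp
    qed
  qed
qed

theorem cover_free_private:
  assumes "cover_free d I A" "2 \<le> d" "finite I" "finite R" "\<forall>c\<in>I. A c \<subseteq> R"
    and "real (card R) < alpha * (real d)\<^sup>2" and "card R \<le> card I + 1"
  shows "\<forall>c\<in>I. \<exists>x. private_point I A c x"
  using assms(1,3-)
proof (induction "card I" arbitrary: I R rule: less_induct)
  case less
  note cf = less.prems(1) and I = less.prems(2) and R = less.prems(3,4) and N = less.prems(5)
    and card_R = less.prems(6)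
  show ?case
  proof (cases "I = {}")
    case False
    obtain d' where d': "d = Suc d'" using assms(2) by (cases d) auto
    have link: "card (I - {c}) \<le> card (R - A c)"
      if "c \<in> I" "real (card (R - A c)) < alpha * (real d - 1)\<^sup>2" for c
      using cover_free_card_le[OF cover_free_link[OF cf[unfolded d'] that(1)], of "R - A c"] that(2) I R d'
      by auto
    have "\<exists>c\<in>I. \<exists>x. private_point I A c x"
      using no_private_card_less[OF cf I False R N _ link] card_R by fastforce
    then obtain c p where cp: "c \<in> I" "private_point I A c p" by blast
    have p: "p \<in> R" "\<forall>b\<in>I - {c}. A b \<subseteq> R - {p}"
      using cp R(2) by (auto simp: private_point_def)
    have lt: "card (I - {c}) < card I" using I cp by (intro psubset_card_mono) auto
    have lI: "Suc (card (I - {c})) = card I" using card_Suc_Diff1[OF I cp(1)] .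
    have lR: "Suc (card (R - {p})) = card R" using card_Suc_Diff1[OF R(1) p(1)] .
    have "real (card (R - {p})) < alpha * (real d)\<^sup>2" using N lR by linarith
    from less.hyps[OF lt cover_free_remove[OF cf] _ _ p(2) this] I R(1) lI lR card_R
    have "\<forall>b\<in>I - {c}. \<exists>x. private_point (I - {c}) A b x" by simp
    then obtain pv where pv: "\<And>b. b \<in> I - {c} \<Longrightarrow> private_point (I - {c}) A b (pv b)" by metis
    \<comment> \<open>The points other than \<open>p\<close> not serving as chosen private points;
      counting leaves at most one.\<close>
    define Z where "Z = R - {p} - pv ` (I - {c})"
    have "inj_on pv (I - {c})"
      using pv unfolding private_point_def inj_on_def by (metis DiffI singletonD)
    then have "card (pv ` (I - {c})) = card (I - {c})" by (rule card_image)
    moreover have "pv ` (I - {c}) \<subseteq> R - {p}" using pv p(2) unfolding private_point_def by blast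
    ultimately have "card Z = card (R - {p}) - card (I - {c})"
      unfolding Z_def using I R(1) by (subst card_Diff_subset) auto
    then have "card Z \<le> Suc 0" using lI lR card_R by linarith
    moreover have "finite Z" using R(1) by (simp add: Z_def)
    ultimately have "\<forall>y\<in>Z. \<forall>z\<in>Z. y = z" by (simp only: card_le_Suc0_iff_eq)
    then have Z1: "y = z" if "y \<in> Z" "z \<in> Z" for y z using that by metis
    have "\<exists>x. private_point I A b x" if b: "b \<in> I - {c}" for b
    proof (cases "pv b \<in> A c")
      case False
      then have "private_point I A b (pv b)" using pv[OF b] unfolding private_point_def by blast
      then show ?thesis by blast
    next
      case True
      \<comment> \<open>Covering by the two members \<open>c\<close> and \<open>a\<close> fails
        because \<open>d\<close> is at least 2. The point left over must be the single element of
        \<open>Z\<close>, hence the same for every \<open>a\<close>, and so private.\<close>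
      have ex: "\<exists>z\<in>Z. z \<in> A b \<and> z \<notin> A c \<and> z \<notin> A a" if a: "a \<in> I - {b}" for a
      proof -
        have "card {c, a} \<le> d" using assms(2) by (cases "c = a") auto
        moreover have "{c, a} \<subseteq> I - {b}" using a b cp by blast
        ultimately obtain z where z: "z \<in> A b" "z \<notin> A c" "z \<notin> A a"
          using cover_freeD[OF cf, of b "{c, a}"] b by auto
        have "z \<noteq> pv e" if "e \<in> I - {c}" for e
          using pv[OF that] z True b unfolding private_point_def by blast
        then have "z \<in> Z" using z(1) p(2) b by (auto simp: Z_def)
        then show ?thesis using z by blast
      qed
      obtain z where z: "z \<in> Z" "z \<in> A b" using ex[of c] cp b by blast
      have "z \<notin> A a" if "a \<in> I - {b}" for a using ex[OF that] Z1[OF z(1)] by blast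
      then show ?thesis using z unfolding private_point_def by blast
    qed
    then show ?thesis using cp by blast
  qed simp
qed

section \<open>From frameproof codes to cover-free families\<close>

text \<open>If the difference sets of the words in \<open>J\<close> cover that of \<open>b\<close>,
  then \<open>b\<close> agrees with \<open>x0\<close> wherever \<open>x0\<close> and all of
  \<open>J\<close> agree, so \<open>b\<close> is a descendant of \<open>insert x0 J\<close>. One of
  the \<open>t\<close> places is taken by \<open>x0\<close>, which leaves
  \<open>t - 1\<close>.\<close>

lemma frameproof_cover_free:
  assumes fp: "wide_sense_frameproof q n t C" and x0: "x0 \<in> C" and t: "0 < t"
  shows "cover_free (t - 1) (C - {x0}) (\<lambda>b. {i. i < n \<and> b $ i \<noteq> x0 $ i})"
  unfolding cover_free_def
proof (intro ballI allI impI notI)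
  fix b J assume b: "b \<in> C - {x0}" and J: "J \<subseteq> C - {x0} - {b}" "card J \<le> t - 1"
    and sub: "{i. i < n \<and> b $ i \<noteq> x0 $ i} \<subseteq> (\<Union>y\<in>J. {i. i < n \<and> y $ i \<noteq> x0 $ i})"
  have CW: "C \<subseteq> words q n" using fp by (simp add: wide_sense_frameproof_def)
  have "card (insert x0 J) \<le> t" using J(2) t card_insert_le_m1[of t J x0] by simp
  moreover have "insert x0 J \<subseteq> C" using J x0 by blast
  ultimately have "wdesc q n (insert x0 J) \<inter> C = insert x0 J"
    using fp unfolding wide_sense_frameproof_def by simp
  moreover have "b \<notin> insert x0 J" using b J by blast
  ultimately have "b \<notin> wdesc q n (insert x0 J)" using b by blast
  then obtain i y where i: "i \<in> undetectable n (insert x0 J)" "y \<in> insert x0 J" "b $ i \<noteq> y $ i"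
    using b CW unfolding wdesc_def by blast
  have all: "y $ i = x0 $ i" if "y \<in> insert x0 J" for y
    using i(1) that unfolding undetectable_def by blast
  have "i < n" using i(1) by (simp add: undetectable_def)
  moreover have "b $ i \<noteq> x0 $ i" using i(3) all[OF i(2)] by metis
  ultimately have "i \<in> {i. i < n \<and> b $ i \<noteq> x0 $ i}" by blast
  then obtain z where "z \<in> J" "z $ i \<noteq> x0 $ i" using sub by blast
  then show False using all by blast
qed

text \<open>Relative to a base word \<open>x0\<close> other than \<open>c\<close> there are
  \<open>n - 1\<close> difference sets on \<open>n\<close> positions. At a private point of
  \<open>c\<close> all other codewords agree with \<open>x0\<close>, and \<open>a\<close> is the
  symbol of \<open>x0\<close> there.\<close>

lemma frameproof_singled_out:
  assumes fp: "wide_sense_frameproof q n t C" and card_C: "card C = n" and t: "3 \<le> t" and n: "3 \<le> n"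
    and bound: "real n < alpha * (real t - 1)\<^sup>2" and c: "c \<in> C"
  shows "\<exists>i<n. \<exists>a. a \<noteq> c $ i \<and> (\<forall>b\<in>C - {c}. b $ i = a)"
proof -
  have finC: "finite C" using card_C n by (intro card_ge_0_finite) simp
  have "card (C - {c}) \<noteq> 0" using card_Suc_Diff1[OF finC c] card_C n by linarith
  then obtain x0 where x0: "x0 \<in> C" "x0 \<noteq> c" by (metis DiffE card.empty equals0I singletonI)
  let ?A = "\<lambda>b. {i. i < n \<and> b $ i \<noteq> x0 $ i}"
  have "real (t - 1) = real t - 1" using t by simp
  then have "\<forall>c\<in>C - {x0}. \<exists>x. private_point (C - {x0}) ?A c x"
    using card_Suc_Diff1[OF finC x0(1)] finC t bound card_C
    by (intro cover_free_private[OF frameproof_cover_free[OF fp x0(1)], of "{..<n}"]) auto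
  then obtain i where i: "private_point (C - {x0}) ?A c i" using c x0 by blast
  then have "i < n" "x0 $ i \<noteq> c $ i" "\<forall>b\<in>C - {c}. b $ i = x0 $ i"
    unfolding private_point_def by auto
  then show ?thesis by blast
qed

section \<open>Standard form\<close>

lemma symbol_equivalent_eq_iff:
  assumes "symbol_equivalent q M M'" "i < dim_row M" "j < dim_col M" "k < dim_col M"
  shows "M' $$ (i, j) = M' $$ (i, k) \<longleftrightarrow> M $$ (i, j) = M $$ (i, k)"
proof -
  obtain \<pi> where \<pi>: "\<pi> permutes {..<q}" "\<forall>j<dim_col M. M' $$ (i, j) = \<pi> (M $$ (i, j))"
    using assms unfolding symbol_equivalent_def by blast
  then show ?thesis using assms(3,4) permutes_inj[OF \<pi>(1)] by (simp add: inj_eq)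
qed

lemma symbol_equivalent_less:
  assumes "symbol_equivalent q M M'" "i < dim_row M" "j < dim_col M" "M $$ (i, j) < q"
  shows "M' $$ (i, j) < q"
proof -
  obtain \<pi> where \<pi>: "\<pi> permutes {..<q}" "\<forall>j<dim_col M. M' $$ (i, j) = \<pi> (M $$ (i, j))"
    using assms unfolding symbol_equivalent_def by blast
  then show ?thesis using assms(3,4) permutes_in_image[OF \<pi>(1), of "M $$ (i, j)"] by simp
qed

lemma standard_form_antimono:
  assumes "standard_form q M" "r < dim_row M" "a \<le> b" "b < q"
  shows "symbol_count M r b \<le> symbol_count M r a"
  using assms(3,4)
proof (induction b rule: dec_induct)
  case (step b)
  then have "symbol_count M r (Suc b) \<le> symbol_count M r b"
    using assms(1,2) by (simp add: standard_form_def)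
  then show ?case using step by simp
qed simp

text \<open>With at least three columns, \<open>a\<close> occurs at least twice, \<open>b\<close>
  once and every other symbol never; nonincreasing counts then leave only one order.\<close>

lemma standard_form_singled_out:
  assumes sf: "standard_form q M" and r: "r < dim_row M" and cols: "3 \<le> dim_col M"
    and j: "j < dim_col M" and a: "a < q" "\<And>k. k < dim_col M \<Longrightarrow> k \<noteq> j \<Longrightarrow> M $$ (r, k) = a"
    and b: "M $$ (r, j) = b" "b < q" "b \<noteq> a"
  shows "a = 0 \<and> b = 1"
proof -
  have cnt: "symbol_count M r s = (if s = a then dim_col M - 1 else if s = b then 1 else 0)" for s
  proof -
    have "{k. k < dim_col M \<and> M $$ (r, k) = s} = (if s = a then {..<dim_col M} - {j} else if s = b then {j} else {})"
      using a(2) b j by auto metis+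
    then show ?thesis using j by (simp add: symbol_count_def)
  qed
  have "a = 0"
    using standard_form_antimono[OF sf r, of 0 a] a cols unfolding cnt by (auto split: if_splits)
  moreover have "b = 1"
    using standard_form_antimono[OF sf r, of 1 b] b cols \<open>a = 0\<close> unfolding cnt by (auto split: if_splits)
  ultimately show ?thesis by simp
qed

section \<open>The two directions of the equivalence\<close>

text \<open>Let \<open>c\<close> be a codeword outside \<open>X\<close> and take the row with the 1
  of its column. There all other codewords agree and \<open>c\<close> differs, which symbol
  permutations preserve. So this position is undetectable for \<open>X\<close> and excludes
  \<open>c\<close> from its descendants.\<close>

lemma permutation_matrix_frameproof:
  assumes CW: "C \<subseteq> words q n" and cs: "distinct cs" "set cs = C"
    and eq: "symbol_equivalent q (mat_of_cols n cs) M" and pm: "permutation_matrix n M"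
  shows "wide_sense_frameproof q n t C \<and> card C = n"
proof
  have dims: "dim_row M = n" "dim_col M = n" using pm by (auto simp: permutation_matrix_def)
  note pm' = pm[unfolded permutation_matrix_def, THEN conjunct2]
  have entries: "M $$ (i, j) \<in> {0, 1}" if "i < n" "j < n" for i j
    using conjunct1[OF pm'] that by blast
  have row: "\<exists>!j. j < n \<and> M $$ (i, j) = 1" if "i < n" for i
    using conjunct1[OF conjunct2[OF pm']] that by simp
  have col: "\<exists>!i. i < n \<and> M $$ (i, j) = 1" if "j < n" for j
    using conjunct2[OF conjunct2[OF pm']] that by simp
  have len: "length cs = n" using eq dims by (simp add: symbol_equivalent_def)
  then show "card C = n" using cs distinct_card by fastforce
  show "wide_sense_frameproof q n t C"
    unfolding wide_sense_frameproof_def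
  proof (intro conjI allI impI CW)
    fix X assume X: "X \<noteq> {} \<and> X \<subseteq> C \<and> card X \<le> t"
    have "X \<subseteq> wdesc q n X"
    proof
      fix x assume x: "x \<in> X"
      then have "\<forall>i\<in>undetectable n X. \<forall>c\<in>X. x $ i = c $ i"
        unfolding undetectable_def by blast
      moreover have "x \<in> words q n" using x X CW by blast
      ultimately show "x \<in> wdesc q n X" unfolding wdesc_def by blast
    qed
    moreover have "c \<notin> wdesc q n X" if c: "c \<in> C" "c \<notin> X" for c
    proof
      assume w: "c \<in> wdesc q n X"
      obtain j where j: "j < n" "cs ! j = c" using c cs len by (metis in_set_conv_nth)
      obtain i where i: "i < n" "M $$ (i, j) = 1" using col[OF j(1)] by blast
      have M0: "M $$ (i, k) = 0" if "k < n" "k \<noteq> j" for k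
      proof -
        have "M $$ (i, k) \<noteq> 1" using row[OF i(1)] i(2) j(1) that by blast
        then show ?thesis using entries[OF i(1) that(1)] by simp
      qed
      have entry: "mat_of_cols n cs $$ (i, k) = cs ! k $ i" if "k < n" for k
        using that i len by (simp add: mat_of_cols_index)
      have iff: "cs ! k $ i = cs ! l $ i \<longleftrightarrow> M $$ (i, k) = M $$ (i, l)" if "k < n" "l < n" for k l
        using symbol_equivalent_eq_iff[OF eq, of i k l] that i len entry by simp
      have idx: "\<exists>k<n. k \<noteq> j \<and> cs ! k = x" if "x \<in> X" for x
      proof -
        have "x \<in> set cs" using that X cs by blast
        then obtain k where "k < n" "cs ! k = x" using len by (metis in_set_conv_nth)
        moreover have "k \<noteq> j" using calculation j that c by metis
        ultimately show ?thesis by blast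
      qed
      have "x $ i = y $ i" if "x \<in> X" "y \<in> X" for x y
        using idx[OF that(1)] idx[OF that(2)] iff M0 by metis
      then have "i \<in> undetectable n X" using i(1) unfolding undetectable_def by blast
      moreover obtain x where x: "x \<in> X" using X by blast
      ultimately have "c $ i = x $ i" using w unfolding wdesc_def by blast
      moreover obtain k where "k < n" "k \<noteq> j" "cs ! k = x" using idx[OF x] by blast
      ultimately show False using iff[of j k] j i M0[of k] by simp
    qed
    ultimately show "wdesc q n X \<inter> C = X" using X by blast
  qed
qed

text \<open>Each column \<open>j\<close> is singled out in some row, and standard form turns that
  row into a unit vector with its 1 at \<open>j\<close>. Distinct columns need distinct rows, so
  these are all \<open>n\<close> rows.\<close>

lemma frameproof_permutation_matrix:
  assumes CW: "C \<subseteq> words q n" and t: "3 \<le> t" and n: "3 \<le> n"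
    and bound: "real n < alpha * (real t - 1)\<^sup>2"
    and cs: "distinct cs" "set cs = C"
    and eq: "symbol_equivalent q (mat_of_cols n cs) M" and sf: "standard_form q M"
    and fp: "wide_sense_frameproof q n t C" and card_C: "card C = n"
  shows "permutation_matrix n M"
proof -
  have len: "length cs = n" using cs card_C distinct_card by fastforce
  have dims: "dim_row M = n" "dim_col M = n" using eq len by (simp_all add: symbol_equivalent_def)
  have entry: "mat_of_cols n cs $$ (i, k) = cs ! k $ i" if "i < n" "k < n" for i k
    using that len by (simp add: mat_of_cols_index)
  have iff: "cs ! k $ i = cs ! l $ i \<longleftrightarrow> M $$ (i, k) = M $$ (i, l)" if "i < n" "k < n" "l < n" for i k l
    using symbol_equivalent_eq_iff[OF eq, of i k l] that len entry by simp
  have inC: "cs ! k \<in> C" if "k < n" for k using that len cs by auto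
  have Mq: "M $$ (i, k) < q" if "i < n" "k < n" for i k
    using symbol_equivalent_less[OF eq, of i k] that len entry inC[OF that(2)] CW by (auto simp: words_def)
  have "\<exists>i<n. M $$ (i, j) = 1 \<and> (\<forall>k<n. k \<noteq> j \<longrightarrow> M $$ (i, k) = 0)" if j: "j < n" for j
  proof -
    obtain i a where i: "i < n" "a \<noteq> cs ! j $ i" "\<forall>b\<in>C - {cs ! j}. b $ i = a"
      using frameproof_singled_out[OF fp card_C t n bound inC[OF j]] by blast
    have others: "cs ! k $ i = a" if "k < n" "k \<noteq> j" for k
      using i(3) inC[OF that(1)] that j cs(1) len by (simp add: nth_eq_iff_index_eq)
    \<comment> \<open>A second column \<open>l\<close> gives access to the common symbol of the
      other entries of row \<open>i\<close> in \<open>M\<close>.\<close>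
    obtain l where l: "l < n" "l \<noteq> j"
      using n that[of 0] that[of 1] by (cases "j = 0") auto
    have eq_l: "M $$ (i, k) = M $$ (i, l)" if "k < n" "k \<noteq> j" for k
      using iff[OF i(1) that(1) l(1)] others that l by simp
    have "M $$ (i, j) \<noteq> M $$ (i, l)"
      using iff[OF i(1) j l(1)] others[OF l] i(2) by simp
    then have "M $$ (i, l) = 0 \<and> M $$ (i, j) = 1"
      using standard_form_singled_out[OF sf, of i j "M $$ (i, l)" "M $$ (i, j)"]
        eq_l dims n i(1) j Mq[OF i(1) l(1)] Mq[OF i(1) j] by simp
    then show ?thesis using i(1) eq_l by metis
  qed
  then obtain \<rho> where \<rho>: "\<And>j. j < n \<Longrightarrow> \<rho> j < n" "\<And>j. j < n \<Longrightarrow> M $$ (\<rho> j, j) = 1"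
    "\<And>j k. j < n \<Longrightarrow> k < n \<Longrightarrow> k \<noteq> j \<Longrightarrow> M $$ (\<rho> j, k) = 0" by metis
  have inj: "inj_on \<rho> {..<n}"
    using \<rho>(2,3) unfolding inj_on_def by (metis lessThan_iff zero_neq_one)
  have "\<rho> ` {..<n} = {..<n}"
    using \<rho>(1) inj by (intro card_subset_eq) (auto simp: card_image)
  then have surj: "\<exists>j<n. \<rho> j = i" if "i < n" for i using that by (metis imageE lessThan_iff)
  have M_eq: "M $$ (\<rho> j, k) = (if k = j then 1 else 0)" if "j < n" "k < n" for j k
    using \<rho> that by simp
  show ?thesis
    unfolding permutation_matrix_def
  proof (intro conjI allI impI)
    show "M \<in> carrier_mat n n" using dims by blast
  next
    fix i j assume "i < n" "j < n"
    then show "M $$ (i, j) \<in> {0, 1}" using surj[of i] M_eq by auto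
  next
    fix i assume "i < n"
    then obtain j where "j < n" "\<rho> j = i" using surj by blast
    then show "\<exists>!j. j < n \<and> M $$ (i, j) = 1" using M_eq by (intro ex1I[of _ j]) (auto split: if_splits)
  next
    fix j assume j: "j < n"
    show "\<exists>!i. i < n \<and> M $$ (i, j) = 1"
    proof (rule ex1I[of _ "\<rho> j"])
      fix i assume i: "i < n \<and> M $$ (i, j) = 1"
      then obtain k where "k < n" "\<rho> k = i" using surj by blast
      then show "i = \<rho> j" using i M_eq[of k j] j by (auto split: if_splits)
    qed (use \<rho> j in auto)
  qed
qed

theorem theorem1p14:
  fixes q t n :: nat and C :: "nat vec set" and M :: "nat mat"
  assumes "q \<ge> 2" and "t \<ge> 3" and "n \<ge> 3"
    and "real n < (15 + sqrt 33) / 24 * (real t - 1)\<^sup>2"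
    and "C \<subseteq> words q n"
    and "standard_representation_matrix q n C M"
  shows "(wide_sense_frameproof q n t C \<and> card C = n) \<longleftrightarrow> permutation_matrix n M"
proof -
  obtain cs where cs: "distinct cs" "set cs = C" "symbol_equivalent q (mat_of_cols n cs) M"
    "standard_form q M"
    using assms(6) unfolding standard_representation_matrix_def representation_matrix_def by blast
  have "real n < alpha * (real t - 1)\<^sup>2" using assms(4) by (simp add: alpha_def)
  then show ?thesis
    using frameproof_permutation_matrix[OF assms(5,2,3) _ cs]
      permutation_matrix_frameproof[OF assms(5) cs(1,2,3)] by blast
qed

end
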